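(* Let $\theta$ be a real number with $\theta/\pi$ irrational, and let $\mu$ be the discrete measure $$\mu=\sum_{k=-\infty}^{\infty}\frac{1}{(k-1/2)^2}\,\delta_{y_k},\qquad y_k=\cos\big((k-1/2)\theta\big),\quad k\in\mathbb{Z},$$ where $\delta_y$ is the unit point mass at $y$. For each integer $j\ge 1$, let $\xi_j$ be the value of $p$ which minimizes $p\theta/(2\pi)-\lfloor p\theta/(2\pi)\rfloor$ over $p\in\{1,2,\ldots,j\}$, let $\eta_j$ be the value of $p$ which minimizes $\lfloor p\theta/(2\pi)\rfloor+1-p\theta/(2\pi)$ over $p\in\{1,2,\ldots,j\}$, and put $$\varepsilon_j=\frac{\xi_j\theta}{2\pi}-\Big\lfloor\frac{\xi_j\theta}{2\pi}\Big\rfloor,\qquad \iota_j=\Big\lfloor\frac{\eta_j\theta}{2\pi}\Big\rfloor+1-\frac{\eta_j\theta}{2\pi}.$$ Then the orthonormal polynomials of $\mu$ are $p_0=\pi^{-1}$ and, for every $n\ge 1$, $$p_n=\frac{(\varepsilon_{2n-1}+\iota_{2n-1})\,T_n-(-1)^{\lfloor \xi_{2n-1}\theta/(2\pi)\rfloor}\,\iota_{2n-1}\,T_{|n-\xi_{2n-1}|}+(-1)^{\lfloor \eta_{2n-1}\theta/(2\pi)\rfloor}\,\varepsilon_{2n-1}\,T_{|n-\eta_{2n-1}|}}{\sqrt{2\pi^2\,\varepsilon_{2n}\,\iota_{2n}\,(\varepsilon_{2n-1}+\iota_{2n-1})}}.$$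
   Context: $T_m$ denotes the Chebyshev polynomial of the first kind of degree $m$, $T_m(\cos\phi)=\cos m\phi$. $\lfloor x\rfloor$ is the largest integer smaller than or equal to $x$. The orthonormal polynomials of $\mu$ are the polynomials $p_n$ of degree $n$ with positive leading coefficient such that $\int p_np_m\,d\mu=\delta_{nm}$, i.e. $\sum_{k\in\mathbb{Z}}(k-1/2)^{-2}p_n(y_k)p_m(y_k)=\delta_{nm}$. Since $\theta/\pi$ is irrational, the minimizers $\xi_j$ and $\eta_j$ are unique. Note that $y_{1-k}=y_k$, so in the sum over all $k\in\mathbb{Z}$ the contributions of $k$ and $1-k$ at the same point are added. *)

theory Defs
  imports "HOL-Analysis.Analysis" "HOL-Computational_Algebra.Computational_Algebra"
begin

definition cheb_T :: "nat \<Rightarrow> real poly" where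
  "cheb_T m = (THE T. degree T = m \<and> (\<forall>\<phi>. poly T (cos \<phi>) = cos (real m * \<phi>)))"

fun cheb_rec :: "nat \<Rightarrow> real poly" where
  "cheb_rec 0 = 1"
| "cheb_rec (Suc 0) = [:0, 1:]"
| "cheb_rec (Suc (Suc m)) = [:0, 2:] * cheb_rec (Suc m) - cheb_rec m"

lemma poly_cheb_rec: "poly (cheb_rec m) (cos \<phi>) = cos (real m * \<phi>)"
proof (induction m rule: cheb_rec.induct)
  case (3 m)
  have "cos (real (Suc (Suc m)) * \<phi>) = cos (real (Suc m) * \<phi> + \<phi>)"
    by (simp add: algebra_simps)
  moreover have "cos (real m * \<phi>) = cos (real (Suc m) * \<phi> - \<phi>)"
    by (simp add: algebra_simps)
  ultimately have "cos (real (Suc (Suc m)) * \<phi>) + cos (real m * \<phi>)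
      = 2 * cos \<phi> * cos (real (Suc m) * \<phi>)"
    unfolding cos_add cos_diff by simp
  with 3 show ?case by (simp add: algebra_simps)
qed auto

lemma degree_cheb_rec: "degree (cheb_rec m) = m"
proof (induction m rule: cheb_rec.induct)
  case (3 m)
  have "cheb_rec (Suc m) \<noteq> 0" using 3(1) by auto
  then have d: "degree ([:0, 2:] * cheb_rec (Suc m)) = Suc (Suc m)"
    using 3(1) by (subst degree_mult_eq) auto
  then have "degree ([:0, 2:] * cheb_rec (Suc m) + (- cheb_rec m)) = Suc (Suc m)"
    using 3(2) by (subst degree_add_eq_left) auto
  then show ?case by simp
qed auto

lemma cheb_T_eq_cheb_rec: "cheb_T m = cheb_rec m"
  unfolding cheb_T_def
proof (rule the_equality)
  show "degree (cheb_rec m) = m \<and> (\<forall>\<phi>. poly (cheb_rec m) (cos \<phi>) = cos (real m * \<phi>))"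
    by (simp add: degree_cheb_rec poly_cheb_rec)
next
  fix T :: "real poly"
  assume T: "degree T = m \<and> (\<forall>\<phi>. poly T (cos \<phi>) = cos (real m * \<phi>))"
  have "poly (T - cheb_rec m) x = 0" if "x \<in> {-1..1}" for x
    using T poly_cheb_rec[of m "arccos x"] that by (metis arccos atLeastAtMost_iff
        cancel_comm_monoid_add_class.diff_cancel cos_arccos poly_diff)
  then have "{-1..1} \<subseteq> {x. poly (T - cheb_rec m) x = 0}" by auto
  moreover have "infinite {-1..1::real}" by (simp add: infinite_Icc)
  ultimately have "infinite {x. poly (T - cheb_rec m) x = 0}" using finite_subset by blast
  then show "T = cheb_rec m" using poly_roots_finite[of "T - cheb_rec m"] by auto
qed

definition node :: "real \<Rightarrow> int \<Rightarrow> real" where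
  "node \<theta> k = cos ((of_int k - 1 / 2) * \<theta>)"

definition weight :: "int \<Rightarrow> real" where
  "weight k = 1 / (of_int k - 1 / 2)\<^sup>2"

text \<open>Taking the image of a weighted counting measure adds up the weights of
  coinciding nodes.\<close>

definition disc_measure :: "real \<Rightarrow> real measure" where
  "disc_measure \<theta> = distr (density (count_space UNIV) (\<lambda>k. ennreal (weight k))) borel (node \<theta>)"

lemma emeasure_disc_measure:
  assumes "A \<in> sets borel"
  shows "emeasure (disc_measure \<theta>) A
    = (\<integral>\<^sup>+ k. ennreal (weight k) * indicator A (node \<theta> k) \<partial>count_space UNIV)"
  using assms unfolding disc_measure_def
  by (subst emeasure_distr)
    (auto simp: emeasure_density intro!: nn_integral_cong split: split_indicator)

definition orthonormal_polys :: "real measure \<Rightarrow> (nat \<Rightarrow> real poly) \<Rightarrow> bool" where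
  "orthonormal_polys M p \<longleftrightarrow>
     (\<forall>n. degree (p n) = n \<and> lead_coeff (p n) > 0) \<and>
     (\<forall>n m. integrable M (\<lambda>x. poly (p n) x * poly (p m) x) \<and>
            (\<integral>x. poly (p n) x * poly (p m) x \<partial>M) = (if n = m then 1 else 0))"

text \<open>When \<open>\<theta> / \<pi>\<close> is irrational and \<open>j \<ge> 1\<close>, the minimizers are unique, so the choice
  made by \<^const>\<open>arg_min_on\<close> is immaterial.\<close>

definition xi :: "real \<Rightarrow> nat \<Rightarrow> nat" where
  "xi \<theta> j = arg_min_on
     (\<lambda>p. real p * \<theta> / (2 * pi) - of_int \<lfloor>real p * \<theta> / (2 * pi)\<rfloor>) {1..j}"

definition eta :: "real \<Rightarrow> nat \<Rightarrow> nat" where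
  "eta \<theta> j = arg_min_on
     (\<lambda>p. of_int \<lfloor>real p * \<theta> / (2 * pi)\<rfloor> + 1 - real p * \<theta> / (2 * pi)) {1..j}"

definition eps :: "real \<Rightarrow> nat \<Rightarrow> real" where
  "eps \<theta> j = real (xi \<theta> j) * \<theta> / (2 * pi) - of_int \<lfloor>real (xi \<theta> j) * \<theta> / (2 * pi)\<rfloor>"

definition iota :: "real \<Rightarrow> nat \<Rightarrow> real" where
  "iota \<theta> j = of_int \<lfloor>real (eta \<theta> j) * \<theta> / (2 * pi)\<rfloor> + 1 - real (eta \<theta> j) * \<theta> / (2 * pi)"

end

theory Submission
  imports Defs
begin

text \<open>The first step is a moment computation. Pairing the indices \<open>k\<close> and \<open>1 - k\<close> turns the
  integral of the Chebyshev polynomial \<open>T\<^sub>m\<close> into the Fourier series of a triangle wave at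
  \<open>m * \<alpha>\<close>, where \<open>\<alpha> = \<theta> / (2 * pi)\<close>: the integral is \<open>pi\<^sup>2 * \<Delta> (m * \<alpha>)\<close>, where \<open>\<Delta>\<close>
  changes sign under a unit shift and equals \<open>1 - 2 * \<bar>u\<bar>\<close> for \<open>\<bar>u\<bar> \<le> 1\<close>
  (\<open>triangle_wave_sums\<close>, \<open>poly_inner_cheb_int\<close>).

  This wave is affine between consecutive integers. Write \<open>\<epsilon>\<close>, \<open>\<iota>\<close>, \<open>\<xi>\<close>, \<open>\<eta>\<close> for the values at
  \<open>2 * n - 1\<close>. Up to an integer, \<open>\<xi> * \<alpha>\<close> is \<open>\<epsilon>\<close> and \<open>\<eta> * \<alpha>\<close> is \<open>- \<iota>\<close>, and the signs in the
  numerator of the formula compensate exactly the sign changes that these integers cause. The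
  inner product of the numerator with \<open>T\<^sub>m\<close> is therefore a sum of the second-difference
  expressions \<open>(\<epsilon> + \<iota>) * \<Delta> v - \<iota> * \<Delta> (v - \<epsilon>) - \<epsilon> * \<Delta> (v + \<iota>)\<close> at \<open>v = (n + m) * \<alpha>\<close> and
  \<open>v = (n - m) * \<alpha>\<close> (\<open>poly_inner_gap_poly_cheb_int\<close>). Such an expression vanishes as soon as no
  integer lies strictly between \<open>v - \<epsilon>\<close> and \<open>v + \<iota>\<close>. For \<open>m < n\<close> both multiples \<open>n + m\<close> and
  \<open>n - m\<close> lie in \<open>{1..2 * n - 1}\<close>, and the extremality of \<open>\<epsilon>\<close> and \<open>\<iota>\<close> on that range says precisely
  that no integer is that close. This is the orthogonality.

  For \<open>m = n\<close> the two points are \<open>0\<close> and \<open>2 * n * \<alpha>\<close>. The second contributes only when \<open>2 * n\<close>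
  sets a new record among the multiples of \<open>\<alpha>\<close>; a record at an even index is attained near an
  odd integer, since otherwise half of it would have been a better approximation at index \<open>n\<close>.
  That determines the sign of the contribution and produces the factor
  \<open>\<epsilon> * \<iota>\<close> taken at index \<open>2 * n\<close> in the norm (\<open>kink_doubled\<close>, \<open>poly_inner_gap_poly_self\<close>).
  Finally, orthonormal polynomials with positive leading coefficients are unique
  (\<open>orthonormal_polys_unique\<close>), which turns the verification into the stated equivalence.\<close>

section \<open>The Fourier series of the triangle wave\<close>

lemma sin_dirichlet_kernel:
  "2 * sin y * (\<Sum>j<N. cos (real (2 * j + 1) * y)) = sin (2 * real N * y)"
proof (induction N)
  case (Suc N)
  have "2 * sin y * cos (real (2 * N + 1) * y)
      = sin (y + real (2 * N + 1) * y) + sin (y - real (2 * N + 1) * y)"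
    by (simp only: sin_add sin_diff)
  also have "\<dots> = sin (2 * real (Suc N) * y) - sin (2 * real N * y)"
    using sin_minus [of "2 * real N * y"] by (simp add: algebra_simps)
  finally show ?case
    using Suc by (simp add: algebra_simps)
qed simp

definition square_sum :: "nat \<Rightarrow> real \<Rightarrow> real" where
  "square_sum N y = (\<Sum>j<N. sin (real (2 * j + 1) * y) / real (2 * j + 1))"

definition triangle_sum :: "nat \<Rightarrow> real \<Rightarrow> real" where
  "triangle_sum N y = (\<Sum>j<N. cos (real (2 * j + 1) * y) / (real (2 * j + 1))\<^sup>2)"

lemma square_sum_deriv:
  "(square_sum N has_real_derivative (\<Sum>j<N. cos (real (2 * j + 1) * y))) (at y within S)"
  unfolding square_sum_def [abs_def]
  by (rule DERIV_sum) (auto intro!: derivative_eq_intros simp: field_simps simp del: of_nat_Suc of_nat_add of_nat_mult)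

lemma triangle_sum_deriv:
  "(triangle_sum N has_real_derivative - square_sum N y) (at y within S)"
  unfolding triangle_sum_def [abs_def] square_sum_def sum_negf [symmetric]
  by (rule DERIV_sum) (auto intro!: derivative_eq_intros simp: field_simps power2_eq_square simp del: of_nat_Suc of_nat_add of_nat_mult)

lemma square_sum_half_pi: "(\<lambda>N. square_sum N (pi / 2)) \<longlonglongrightarrow> pi / 4"
proof -
  have "sin (real (2 * j + 1) * (pi / 2)) = (-1) ^ j" for j
  proof -
    have "real (2 * j + 1) * (pi / 2) = pi / 2 + real j * pi" by (simp add: field_simps)
    then show ?thesis by (simp only: sin_add sin_npi cos_npi) simp
  qed
  then have "square_sum N (pi / 2) = (\<Sum>j<N. (-1) ^ j * (1 / real (j * 2 + 1)))" for N
    unfolding square_sum_def by (intro sum.cong) (simp_all add: mult.commute)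
  moreover have "(\<lambda>j. (-1) ^ j * (1 / real (j * 2 + 1))) sums (pi / 4)"
  proof -
    have "(\<lambda>j. (-1) ^ j * 1 / real (j * 2 + 1)) sums (\<Sum>j. (-1) ^ j * 1 / real (j * 2 + 1))"
      using summable_arctan_series [of 1] by (intro summable_sums) simp
    then show ?thesis by (simp only: pi_series [symmetric]) simp
  qed
  ultimately show ?thesis by (simp add: sums_def)
qed

text \<open>The derivative of the partial sum is \<open>sin (2 * N * t) / (2 * sin t)\<close>. One integration by parts,
  carried out by adding the small correction \<open>cos (2 * N * t) / (4 * N * sin t)\<close>, leaves a
  derivative of order \<open>1 / N\<close>. Hence the sine sums are constant up to \<open>1 / N\<close> away from
  \<open>0\<close>, and the constant is read off from the Leibniz series at \<open>pi / 2\<close>.\<close>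

lemma square_sum_bound:
  assumes "0 < c" "c \<le> y" "y \<le> pi / 2" "N > 0"
  shows "\<bar>square_sum N y - pi / 4\<bar>
    \<le> (1 + pi) / (real N * (sin c)\<^sup>2) + \<bar>square_sum N (pi / 2) - pi / 4\<bar>"
proof -
  define E where "E t = square_sum N t + cos (2 * real N * t) / (4 * real N * sin t)" for t
  have sc: "0 < sin c" using assms pi_gt_zero by (intro sin_gt_zero) linarith+
  have st: "sin c \<le> sin t" if "t \<in> {c..pi/2}" for t
    using that assms by (intro sin_monotone_2pi_le) auto
  have dE: "(E has_real_derivative - (cos (2 * real N * t) * cos t / (4 * real N * (sin t)\<^sup>2))) (at t within {c..pi/2})"
    if "t \<in> {c..pi/2}" for t
  proof -
    have s: "sin t > 0" using st [OF that] sc by linarith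
    have k: "(\<Sum>j<N. cos (real (2 * j + 1) * t)) = sin (2 * real N * t) / (2 * sin t)"
      using sin_dirichlet_kernel [of t N] s by (simp add: field_simps)
    show ?thesis
      unfolding E_def [abs_def]
      using s \<open>N > 0\<close>
      apply (auto intro!: derivative_eq_intros square_sum_deriv)
      apply (subst k [simplified])
      by (simp add: field_simps power2_eq_square)
  qed
  have "norm (E y - E (pi/2)) \<le> 1 / (4 * real N * (sin c)\<^sup>2) * norm (y - pi/2)"
  proof (rule field_differentiable_bound [where S = "{c..pi/2}", OF _ dE])
    fix t assume t: "t \<in> {c..pi/2}"
    have "\<bar>cos (2 * real N * t)\<bar> * \<bar>cos t\<bar> \<le> 1 * 1"
      by (intro mult_mono) auto
    then show "norm (- (cos (2 * real N * t) * cos t / (4 * real N * (sin t)\<^sup>2))) \<le> 1 / (4 * real N * (sin c)\<^sup>2)"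
      using st [OF t] sc \<open>N > 0\<close>
      by (auto simp: abs_mult intro!: frac_le mult_left_mono power_mono mult_pos_pos)
  qed (use assms in auto)
  also have "\<dots> \<le> 1 / (4 * real N * (sin c)\<^sup>2) * pi"
    using assms by (intro mult_left_mono) auto
  finally have 1: "\<bar>E y - E (pi/2)\<bar> \<le> pi / (4 * real N * (sin c)\<^sup>2)" by simp
  have 2: "\<bar>cos (2 * real N * t) / (4 * real N * sin t)\<bar> \<le> 1 / (4 * real N * (sin c)\<^sup>2)"
    if "t \<in> {c..pi/2}" for t
  proof -
    have "(sin c)\<^sup>2 \<le> sin c * 1"
      unfolding power2_eq_square using sc by (intro mult_left_mono) auto
    then have "(sin c)\<^sup>2 \<le> sin t" using st [OF that] by linarith
    then show ?thesis
      using st [OF that] sc \<open>N > 0\<close>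
      by (auto simp: abs_mult intro!: frac_le mult_left_mono mult_pos_pos)
  qed
  have "\<bar>square_sum N y - square_sum N (pi/2)\<bar>
      \<le> pi / (4 * real N * (sin c)\<^sup>2) + 2 * (1 / (4 * real N * (sin c)\<^sup>2))"
    using 1 2 [of y] 2 [of "pi/2"] assms unfolding E_def atLeastAtMost_iff by linarith
  also have "\<dots> = ((2 + pi) / 4) / (real N * (sin c)\<^sup>2)" by (simp add: add_divide_distrib)
  also have "\<dots> \<le> (1 + pi) / (real N * (sin c)\<^sup>2)"
    using pi_gt_zero by (intro divide_right_mono) auto
  finally show ?thesis by linarith
qed

text \<open>The cosine sums vanish at \<open>pi / 2\<close> and their derivatives tend to \<open>- pi / 4\<close> uniformly on
  \<open>{c..pi / 2}\<close>, so the limit is the affine function with these data.\<close>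

lemma triangle_sum_lim_first_quarter:
  assumes "0 < c" "c \<le> pi / 2"
  shows "(\<lambda>N. triangle_sum N c) \<longlonglongrightarrow> pi / 4 * (pi / 2 - c)"
proof -
  define b where "b N = (1 + pi) / (real N * (sin c)\<^sup>2) + \<bar>square_sum N (pi / 2) - pi / 4\<bar>" for N
  have sc: "0 < sin c" using assms pi_gt_zero by (intro sin_gt_zero) linarith+
  have "(\<lambda>N. (1 + pi) / (sin c)\<^sup>2 * inverse (real N) + \<bar>square_sum N (pi / 2) - pi / 4\<bar>)
      \<longlonglongrightarrow> (1 + pi) / (sin c)\<^sup>2 * 0 + \<bar>pi / 4 - pi / 4\<bar>"
    by (intro tendsto_intros square_sum_half_pi lim_inverse_n)
  then have b0: "b \<longlonglongrightarrow> 0"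
    unfolding b_def [abs_def] by (simp add: field_simps)
  have z: "triangle_sum N (pi / 2) = 0" for N
    unfolding triangle_sum_def
    using cos_pi_eq_zero by (auto intro!: sum.neutral simp: mult.commute)
  have "\<forall>\<^sub>F N in sequentially. norm (triangle_sum N c - pi / 4 * (pi / 2 - c)) \<le> b N * (pi/2)"
  proof (rule eventually_mono [OF eventually_gt_at_top [of 0]])
    fix N :: nat assume N: "0 < N"
    let ?f = "\<lambda>t. triangle_sum N t - pi / 4 * (pi / 2 - t)"
    have "norm (?f c - ?f (pi/2)) \<le> b N * norm (c - pi/2)"
    proof (rule field_differentiable_bound [where S = "{c..pi/2}" and f' = "\<lambda>t. - square_sum N t + pi/4"])
      show "(?f has_real_derivative - square_sum N t + pi/4) (at t within {c..pi/2})" for t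
        by (auto intro!: derivative_eq_intros triangle_sum_deriv)
      show "norm (- square_sum N t + pi/4) \<le> b N" if "t \<in> {c..pi/2}" for t
        using square_sum_bound [of c t N] assms that N unfolding b_def by simp
    qed (use assms in auto)
    also have "\<dots> \<le> b N * (pi/2)"
      using assms N sc unfolding b_def by (intro mult_left_mono add_nonneg_nonneg) auto
    finally show "norm (?f c) \<le> b N * (pi/2)" by (simp add: z)
  qed
  moreover have "(\<lambda>N. b N * (pi/2)) \<longlonglongrightarrow> 0"
    using tendsto_mult_left_zero [OF b0] .
  ultimately have "(\<lambda>N. triangle_sum N c - pi / 4 * (pi / 2 - c)) \<longlonglongrightarrow> 0"
    by (rule Lim_null_comparison)
  then show ?thesis by (simp add: LIM_zero_iff)
qed

lemma odd_inverse_squares_sums: "(\<lambda>j. 1 / (real (2 * j + 1))\<^sup>2) sums (pi\<^sup>2 / 8)"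
proof -
  have all: "(\<lambda>n. 1 / (real n + 1)\<^sup>2) sums (pi\<^sup>2 / 6)"
    using inverse_squares_sums by (simp add: add_ac)
  have ev: "(\<lambda>n. 1 / (2 * (real n + 1))\<^sup>2) sums (pi\<^sup>2 / 24)"
    using sums_mult [OF all, of "1/4"] by (simp only: power_mult_distrib) simp
  have "(\<lambda>n. \<Sum>i\<in>{n * 2..<n * 2 + 2}. 1 / (real i + 1)\<^sup>2) sums (pi\<^sup>2 / 6)"
    by (rule sums_group [OF all]) simp
  then have "(\<lambda>n. 1 / (real (2 * n + 1))\<^sup>2 + 1 / (2 * (real n + 1))\<^sup>2) sums (pi\<^sup>2 / 6)"
    by (simp add: numeral_2_eq_2 algebra_simps)
  from sums_diff [OF this ev] show ?thesis by simp
qed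

text \<open>Normalised to height \<open>1\<close> and antiperiod \<open>1\<close>.\<close>

definition triangle_wave :: "real \<Rightarrow> real" where
  "triangle_wave u = (-1) powi \<lfloor>u\<rfloor> * (1 - 2 * frac u)"

lemma triangle_wave_add_int: "triangle_wave (u + of_int n) = (-1) powi n * triangle_wave u"
  unfolding triangle_wave_def by (simp add: power_int_add)

lemma triangle_wave_near_zero: "\<bar>u\<bar> \<le> 1 \<Longrightarrow> triangle_wave u = 1 - 2 * \<bar>u\<bar>"
proof -
  have base: "triangle_wave u = 1 - 2 * u" if "0 \<le> u" "u < 1" for u :: real
    using that floor_unique [of 0 u] by (simp add: triangle_wave_def frac_def)
  assume u: "\<bar>u\<bar> \<le> 1"
  consider "0 \<le> u" "u < 1" | "u < 0" | "u = 1" using u by linarith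
  then show ?thesis
  proof cases
    case 1 then show ?thesis by (simp add: base)
  next
    case 2
    then show ?thesis using triangle_wave_add_int [of "u + 1" "-1"] base [of "u + 1"] u by simp
  next
    case 3
    then show ?thesis using triangle_wave_add_int [of 0 1] base [of 0] by simp
  qed
qed

text \<open>Both sides are even and change sign under a unit shift, so the interval \<open>{0..1/2}\<close> suffices.\<close>

lemma triangle_wave_sums:
  "(\<lambda>j. cos (real (2 * j + 1) * (pi * u)) / (real (2 * j + 1))\<^sup>2) sums (pi\<^sup>2 / 8 * triangle_wave u)"
proof -
  let ?S = "\<lambda>u. (\<lambda>j. cos (real (2 * j + 1) * (pi * u)) / (real (2 * j + 1))\<^sup>2) sums (pi\<^sup>2 / 8 * triangle_wave u)"
  have quarter: "?S u" if "0 \<le> u" "u \<le> 1/2" for u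
  proof (cases "u = 0")
    case True
    then show ?thesis using odd_inverse_squares_sums by (simp add: triangle_wave_near_zero)
  next
    case False
    then have "(\<lambda>N. triangle_sum N (pi * u)) \<longlonglongrightarrow> pi / 4 * (pi / 2 - pi * u)"
      using that by (intro triangle_sum_lim_first_quarter) auto
    moreover have "pi / 4 * (pi / 2 - pi * u) = pi\<^sup>2 / 8 * triangle_wave u"
      using that by (simp add: triangle_wave_near_zero power2_eq_square field_simps)
    ultimately show ?thesis by (simp only: sums_def triangle_sum_def)
  qed
  have shift: "?S (v + of_int n)" if "?S v" for v n
  proof -
    have "cos (real (2 * j + 1) * (pi * (v + of_int n))) = (-1) powi n * cos (real (2 * j + 1) * (pi * v))" for j
    proof -
      have "real (2 * j + 1) * (pi * (v + of_int n))
          = real (2 * j + 1) * (pi * v) + pi * of_int (int (2 * j + 1) * n)"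
        by (simp add: algebra_simps)
      moreover have "sin (pi * of_int (int (2 * j + 1) * n)) = 0"
        by (simp only: sin_npi_int)
      moreover have "cos (pi * of_int (int (2 * j + 1) * n)) = (-1) powi n"
        by (simp only: cos_npi_int) (auto simp: power_int_minus_left)
      ultimately show ?thesis by (simp only: cos_add) simp
    qed
    then show ?thesis
      using sums_mult [OF that, of "(-1) powi n"]
      by (simp only: triangle_wave_add_int) (simp add: mult_ac)
  qed
  have refl: "?S (- v)" if "?S v" for v
  proof -
    have "triangle_wave (- v) = triangle_wave v"
    proof -
      have "triangle_wave (- v) = triangle_wave (- frac v + of_int (- \<lfloor>v\<rfloor>))" by (simp add: frac_def)
      also have "\<dots> = (-1) powi \<lfloor>v\<rfloor> * triangle_wave (- frac v)"
        by (simp only: triangle_wave_add_int power_int_minus_one_minus)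
      also have "triangle_wave (- frac v) = triangle_wave (frac v)"
        using frac_ge_0 [of v] frac_lt_1 [of v] by (simp add: triangle_wave_near_zero)
      also have "(-1) powi \<lfloor>v\<rfloor> * triangle_wave (frac v) = triangle_wave v"
        using triangle_wave_add_int [of "frac v" "\<lfloor>v\<rfloor>"] by (simp add: frac_def)
      finally show ?thesis .
    qed
    then show ?thesis using that by simp
  qed
  have "?S (frac u)"
  proof (cases "frac u \<le> 1/2")
    case True then show ?thesis by (intro quarter) auto
  next
    case False
    then have "?S (1 - frac u)"
      using frac_lt_1 [of u] by (intro quarter) auto
    from shift [OF refl [OF this], of 1] show ?thesis by simp
  qed
  from shift [OF this, of "\<lfloor>u\<rfloor>"] show ?thesis by (simp add: frac_def)
qed

section \<open>Orthogonality and uniqueness for a measure with finite moments\<close>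

definition poly_inner :: "real measure \<Rightarrow> real poly \<Rightarrow> real poly \<Rightarrow> real" where
  "poly_inner M f g = (\<integral>x. poly (f * g) x \<partial>M)"

lemma poly_inner_0_right: "poly_inner M f 0 = 0"
  by (simp add: poly_inner_def)

lemma poly_inner_commute: "poly_inner M f g = poly_inner M g f"
  by (simp add: poly_inner_def mult.commute)

lemma subtract_leading:
  fixes f b :: "real poly"
  assumes "degree b = degree f" "b \<noteq> 0"
  defines "r \<equiv> f - smult (lead_coeff f / lead_coeff b) b"
  shows "r = 0 \<or> degree r < degree f"
proof (rule eq_zero_or_degree_less)
  show "degree r \<le> degree f"
    unfolding r_def using assms(1) by (intro degree_diff_le degree_smult_le [THEN order_trans]) auto
  show "coeff r (degree f) = 0"
    unfolding r_def using assms(1) \<open>b \<noteq> 0\<close> by (simp flip: assms(1))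
qed

lemma poly_inner_smult_right: "poly_inner M f (smult c g) = c * poly_inner M f g"
  by (simp add: poly_inner_def mult.left_commute)

context
  fixes M :: "real measure"
  assumes moments: "\<And>f. integrable M (poly f)"
begin

lemma poly_inner_add: "poly_inner M (f + g) h = poly_inner M f h + poly_inner M g h"
  using Bochner_Integration.integral_add [OF moments moments, of "f * h" "g * h"]
  by (simp only: poly_inner_def distrib_right poly_add)

lemma poly_inner_smult: "poly_inner M (smult c f) h = c * poly_inner M f h"
  by (simp add: poly_inner_def mult.assoc)

lemma poly_inner_diff: "poly_inner M (f - g) h = poly_inner M f h - poly_inner M g h"
  using Bochner_Integration.integral_diff [OF moments moments, of "f * h" "g * h"]
  by (simp only: poly_inner_def left_diff_distrib poly_diff)

lemmas poly_inner_linear = poly_inner_add poly_inner_diff poly_inner_smult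

lemma orthogonal_lower_degree:
  assumes "\<And>m. m < n \<Longrightarrow> degree (b m) = m \<and> b m \<noteq> 0"
    and "\<And>m. m < n \<Longrightarrow> poly_inner M f (b m) = 0"
    and "degree g < n"
  shows "poly_inner M f g = 0"
  using assms(3)
proof (induction "degree g" arbitrary: g rule: less_induct)
  case less
  let ?b = "b (degree g)" and ?c = "lead_coeff g / lead_coeff (b (degree g))"
  let ?r = "g - smult ?c ?b"
  have "?r = 0 \<or> degree ?r < degree g"
    using less.prems assms(1) by (intro subtract_leading) auto
  then have "poly_inner M f ?r = 0"
  proof
    assume "?r = 0"
    then show ?thesis by (simp only: poly_inner_0_right)
  next
    assume "degree ?r < degree g"
    then show ?thesis using less by simp
  qed
  then have "poly_inner M g f = ?c * poly_inner M ?b f"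
    by (simp add: poly_inner_commute [of M f] poly_inner_linear)
  then show ?case
    using assms(2) less.prems by (simp add: poly_inner_commute [of M _ f])
qed

lemma orthonormal_polys_iff:
  "orthonormal_polys M p \<longleftrightarrow>
     (\<forall>n. degree (p n) = n \<and> lead_coeff (p n) > 0) \<and>
     (\<forall>n m. poly_inner M (p n) (p m) = (if n = m then 1 else 0))"
  by (simp add: orthonormal_polys_def poly_inner_def moments flip: poly_mult)

lemma orthonormal_polys_orthogonal_lower:
  assumes "orthonormal_polys M p" "degree g < n"
  shows "poly_inner M (p n) g = 0"
proof (rule orthogonal_lower_degree [where b = p, OF _ _ assms(2)])
  show "degree (p m) = m \<and> p m \<noteq> 0" for m
    using assms(1) unfolding orthonormal_polys_iff by (metis leading_coeff_0_iff less_irrefl)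
  show "poly_inner M (p n) (p m) = 0" if "m < n" for m
    using assms(1) that by (simp add: orthonormal_polys_iff)
qed

text \<open>Subtracting from \<open>p n\<close> the multiple of \<open>q n\<close> with the same leading term leaves a remainder of
  degree below \<open>n\<close> that is still orthogonal to all lower degrees. Pairing it with the \<open>q d\<close> of its
  own degree extracts its leading coefficient, which must vanish. Normalisation and the sign
  condition then fix the multiple.\<close>

lemma orthonormal_polys_unique:
  assumes p: "orthonormal_polys M p" and q: "orthonormal_polys M q"
  shows "p = q"
proof
  fix n
  note P = p [unfolded orthonormal_polys_iff, THEN conjunct1]
  note Q = q [unfolded orthonormal_polys_iff, THEN conjunct1]
  note deg = P [THEN spec, THEN conjunct1] Q [THEN spec, THEN conjunct1]
    P [THEN spec, THEN conjunct2] Q [THEN spec, THEN conjunct2]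
  have nz: "q m \<noteq> 0" for m
    using deg(4) [of m] by auto
  have norm: "poly_inner M (p m) (p m) = 1" "poly_inner M (q m) (q m) = 1" for m
    using p q unfolding orthonormal_polys_iff by auto
  define c where "c = lead_coeff (p n) / lead_coeff (q n)"
  define r where "r = p n - smult c (q n)"
  have "c > 0" using deg by (simp add: c_def)
  have small: "r = 0 \<or> degree r < n"
    using subtract_leading [of "q n" "p n"] deg nz by (simp add: r_def c_def)
  have "r = 0"
  proof (rule ccontr)
    assume "r \<noteq> 0"
    define d where "d = degree r"
    have "d < n" using small \<open>r \<noteq> 0\<close> by (simp add: d_def)
    then have "poly_inner M (p n) (q d) = 0" "poly_inner M (q n) (q d) = 0"
      using orthonormal_polys_orthogonal_lower [OF p, of "q d" n]
        orthonormal_polys_orthogonal_lower [OF q, of "q d" n] by (simp_all only: deg)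
    then have 0: "poly_inner M r (q d) = 0" by (simp add: r_def poly_inner_linear)
    define a where "a = lead_coeff r / lead_coeff (q d)"
    have "r - smult a (q d) = 0 \<or> degree (r - smult a (q d)) < d"
      using subtract_leading [of "q d" r] deg nz by (simp add: a_def d_def)
    then have "poly_inner M (q d) (r - smult a (q d)) = 0"
    proof
      assume "r - smult a (q d) = 0"
      then show ?thesis by (simp only: poly_inner_0_right)
    qed (rule orthonormal_polys_orthogonal_lower [OF q])
    then have "poly_inner M r (q d) = a"
      using norm by (simp add: poly_inner_commute [of M "q d"] poly_inner_linear)
    then show False using 0 \<open>r \<noteq> 0\<close> deg [of d] by (simp add: a_def)
  qed
  then have pq: "p n = smult c (q n)" by (simp add: r_def)
  then have "c\<^sup>2 = 1"
    using norm(1) [of n] norm(2) [of n]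
    by (simp add: poly_inner_smult poly_inner_smult_right power2_eq_square)
  then have "c = 1"
    using \<open>c > 0\<close> by (auto simp: power2_eq_1_iff)
  then show "p n = q n" using pq by simp
qed

end
section \<open>Inner products of Chebyshev polynomials\<close>

lemma node_half: "node \<theta> (int j + 1) = cos (real (2 * j + 1) * (\<theta> / 2))"
    "node \<theta> (- int j) = cos (real (2 * j + 1) * (\<theta> / 2))"
proof -
  show "node \<theta> (int j + 1) = cos (real (2 * j + 1) * (\<theta> / 2))"
    unfolding node_def by (rule arg_cong [of _ _ cos]) (simp add: field_simps)
  have "node \<theta> (- int j) = cos (- (real (2 * j + 1) * (\<theta> / 2)))"
    unfolding node_def by (rule arg_cong [of _ _ cos]) (simp add: field_simps)
  then show "node \<theta> (- int j) = cos (real (2 * j + 1) * (\<theta> / 2))" by simp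
qed

lemma weight_half: "weight (int j + 1) = 4 / (real (2 * j + 1))\<^sup>2"
    "weight (- int j) = 4 / (real (2 * j + 1))\<^sup>2"
proof -
  have "of_int (int j + 1) - 1 / 2 = real (2 * j + 1) / 2"
    "of_int (- int j) - 1 / 2 = - (real (2 * j + 1) / 2)"
    by (simp_all add: field_simps)
  then show "weight (int j + 1) = 4 / (real (2 * j + 1))\<^sup>2"
    "weight (- int j) = 4 / (real (2 * j + 1))\<^sup>2"
    unfolding weight_def by (simp_all only: power2_minus) (simp_all add: power_divide)
qed

lemma int_pos_nonpos:
  "bij_betw (\<lambda>j. int j + 1) UNIV {1..}" "bij_betw (\<lambda>j. - int j) UNIV {..0}"
  by (rule bij_betw_byWitness [where f' = "\<lambda>k. nat (k - 1)"], auto)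
     (rule bij_betw_byWitness [where f' = "\<lambda>k. nat (- k)"], auto)

text \<open>The indices \<open>j + 1\<close> and \<open>- j\<close> carry the same node and the same weight, so the two-sided sum
  folds into a series over the odd multiples of \<open>\<theta> / 2\<close>.\<close>

lemma disc_integral_poly:
  fixes f :: "real poly"
  shows disc_integrable_poly: "integrable (disc_measure \<theta>) (poly f)"
    and disc_integral_poly_sums:
      "(\<lambda>j. 8 / (real (2 * j + 1))\<^sup>2 * poly f (cos (real (2 * j + 1) * (\<theta> / 2))))
         sums (\<integral>x. poly f x \<partial>disc_measure \<theta>)"
proof -
  let ?h = "\<lambda>k. weight k * poly f (node \<theta> k)"
  let ?g = "\<lambda>j. 4 / (real (2 * j + 1))\<^sup>2 * poly f (cos (real (2 * j + 1) * (\<theta> / 2)))"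
  have pm: "poly f \<in> borel_measurable borel"
    by (intro borel_measurable_continuous_onI continuous_intros)
  have w: "weight k \<ge> 0" for k by (simp add: weight_def)
  have "bounded (poly f ` {-1..1})"
    by (intro compact_imp_bounded compact_continuous_image continuous_intros) auto
  then obtain K where K: "\<And>x. x \<in> {-1..1} \<Longrightarrow> norm (poly f x) \<le> K"
    unfolding bounded_iff by blast
  have "summable (\<lambda>j. norm (?g j))"
  proof (rule summable_comparison_test')
    show "summable (\<lambda>j. 4 * K * (1 / (real (2 * j + 1))\<^sup>2))"
      using odd_inverse_squares_sums by (intro summable_mult) (rule sums_summable)
    show "norm (norm (?g j)) \<le> 4 * K * (1 / (real (2 * j + 1))\<^sup>2)" if "j \<ge> 0" for j
      using K [of "cos (real (2 * j + 1) * (\<theta> / 2))"]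
      by (simp add: abs_mult divide_right_mono del: of_nat_Suc of_nat_add of_nat_mult)
  qed
  then have g: "Infinite_Set_Sum.abs_summable_on ?g UNIV" by (simp only: abs_summable_on_nat_iff')
  have hg: "?h (int j + 1) = ?g j" "?h (- int j) = ?g j" for j
    by (simp_all only: node_half weight_half)
  have h1: "Infinite_Set_Sum.abs_summable_on ?h {1..}" and h0: "Infinite_Set_Sum.abs_summable_on ?h {..0}"
    using g by (simp_all only: abs_summable_on_reindex_bij_betw [OF int_pos_nonpos(1), symmetric]
        abs_summable_on_reindex_bij_betw [OF int_pos_nonpos(2), symmetric] hg)
  have U: "(UNIV :: int set) = {1..} \<union> {..0}" by auto
  have h: "Infinite_Set_Sum.abs_summable_on ?h UNIV" unfolding U using h1 h0 by (rule abs_summable_on_union)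
  have "infsetsum ?h UNIV = infsetsum ?h {1..} + infsetsum ?h {..0}"
    unfolding U using h1 h0 by (rule infsetsum_Un_disjoint) auto
  also have "\<dots> = infsetsum ?g UNIV + infsetsum ?g UNIV"
    by (simp only: infsetsum_reindex_bij_betw [OF int_pos_nonpos(1), symmetric]
        infsetsum_reindex_bij_betw [OF int_pos_nonpos(2), symmetric] hg)
  finally have tot: "infsetsum ?h UNIV = 2 * infsetsum ?g UNIV" by simp
  have "?g sums infsetsum ?g UNIV" by (rule sums_infsetsum_nat' [OF g])
  from sums_mult [OF this, of 2]
  have S: "(\<lambda>j. 8 / (real (2 * j + 1))\<^sup>2 * poly f (cos (real (2 * j + 1) * (\<theta> / 2)))) sums infsetsum ?h UNIV"
    by (simp add: tot)
  show "integrable (disc_measure \<theta>) (poly f)"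
    unfolding disc_measure_def
    using h pm w by (simp add: integrable_distr_eq integrable_density abs_summable_on_def)
  have "(\<integral>x. poly f x \<partial>disc_measure \<theta>) = infsetsum ?h UNIV"
    unfolding disc_measure_def infsetsum_def
    using pm w by (simp add: integral_distr integral_density)
  with S show "(\<lambda>j. 8 / (real (2 * j + 1))\<^sup>2 * poly f (cos (real (2 * j + 1) * (\<theta> / 2))))
         sums (\<integral>x. poly f x \<partial>disc_measure \<theta>)" by simp
qed

text \<open>Signed indices let \<open>T\<^bsub>\<bar>n - \<xi>\<bar>\<^esub>\<close> be handled without distinguishing the sign of \<open>n - \<xi>\<close>,
  because the cosine is even.\<close>

definition cheb_int :: "int \<Rightarrow> real poly" where
  "cheb_int k = cheb_T (nat \<bar>k\<bar>)"

lemma poly_cheb_int: "poly (cheb_int k) (cos x) = cos (of_int k * x)"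
proof -
  have "poly (cheb_int k) (cos x) = cos (\<bar>of_int k\<bar> * x)"
    by (simp add: cheb_int_def cheb_T_eq_cheb_rec poly_cheb_rec)
  also have "\<dots> = cos (of_int k * x)"
    by (cases "k \<ge> 0") auto
  finally show ?thesis .
qed

text \<open>The product-to-sum formula reduces the product to two cosine series of the triangle wave.\<close>

lemma poly_inner_cheb_int:
  "poly_inner (disc_measure \<theta>) (cheb_int a) (cheb_int b)
   = pi\<^sup>2 / 2 * (triangle_wave (of_int (a + b) * (\<theta> / (2 * pi))) + triangle_wave (of_int (a - b) * (\<theta> / (2 * pi))))"
proof (rule sums_unique2)
  show "(\<lambda>j. 8 / (real (2 * j + 1))\<^sup>2 * poly (cheb_int a * cheb_int b) (cos (real (2 * j + 1) * (\<theta> / 2))))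
    sums poly_inner (disc_measure \<theta>) (cheb_int a) (cheb_int b)"
    unfolding poly_inner_def by (rule disc_integral_poly_sums)
  let ?t = "\<lambda>c::int. pi * (of_int c * (\<theta> / (2 * pi)))"
  have "(\<lambda>j. 4 * (cos (real (2 * j + 1) * ?t (a + b)) / (real (2 * j + 1))\<^sup>2 + cos (real (2 * j + 1) * ?t (a - b)) / (real (2 * j + 1))\<^sup>2))
    sums (4 * (pi\<^sup>2 / 8 * triangle_wave (of_int (a + b) * (\<theta> / (2 * pi))) + pi\<^sup>2 / 8 * triangle_wave (of_int (a - b) * (\<theta> / (2 * pi)))))"
    by (intro sums_mult sums_add triangle_wave_sums)
  moreover have "4 * (cos (real (2 * j + 1) * ?t (a + b)) / (real (2 * j + 1))\<^sup>2 + cos (real (2 * j + 1) * ?t (a - b)) / (real (2 * j + 1))\<^sup>2)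
    = 8 / (real (2 * j + 1))\<^sup>2 * poly (cheb_int a * cheb_int b) (cos (real (2 * j + 1) * (\<theta> / 2)))" for j
  proof -
    define x where "x = real (2 * j + 1) * (\<theta> / 2)"
    have "real (2 * j + 1) * ?t (a + b) = of_int a * x + of_int b * x"
      "real (2 * j + 1) * ?t (a - b) = of_int a * x - of_int b * x"
      by (simp_all add: x_def field_simps)
    then show ?thesis
      unfolding x_def [symmetric] poly_mult poly_cheb_int
      by (simp only: cos_add cos_diff) (simp add: field_simps)
  qed
  ultimately show "(\<lambda>j. 8 / (real (2 * j + 1))\<^sup>2 * poly (cheb_int a * cheb_int b) (cos (real (2 * j + 1) * (\<theta> / 2))))
    sums (pi\<^sup>2 / 2 * (triangle_wave (of_int (a + b) * (\<theta> / (2 * pi))) + triangle_wave (of_int (a - b) * (\<theta> / (2 * pi)))))"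
    by (simp only:) (simp add: algebra_simps)
qed

section \<open>Deviation of the triangle wave from linearity\<close>

lemma triangle_wave_near_int:
  assumes "\<bar>x - of_int n\<bar> \<le> 1"
  shows "triangle_wave x = (-1) powi n * (1 - 2 * \<bar>x - of_int n\<bar>)"
  using triangle_wave_add_int [of "x - of_int n" n] assms by (simp add: triangle_wave_near_zero)

text \<open>Up to the factor \<open>e + i\<close>, this compares the wave at \<open>v\<close> with the linear interpolation of its
  values at \<open>v - e\<close> and \<open>v + i\<close>; it is nonzero only when a kink of the wave lies in between.\<close>

definition kink :: "real \<Rightarrow> real \<Rightarrow> real \<Rightarrow> real" where
  "kink e i v = (e + i) * triangle_wave v - i * triangle_wave (v - e) - e * triangle_wave (v + i)"

lemma kink_linear:
  assumes "0 \<le> e" "0 \<le> i" "e \<le> frac v" "i \<le> 1 - frac v"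
  shows "kink e i v = 0"
proof -
  define u where "u = frac v"
  define N where "N = \<lfloor>v\<rfloor>"
  have v: "v = of_int N + u" by (simp add: u_def N_def frac_def)
  have "0 \<le> u - e" "u + i \<le> 1" "0 \<le> u" "u \<le> 1"
    using assms frac_lt_1 [of v] by (auto simp: u_def)
  then have t: "triangle_wave (of_int N + u) = (-1) powi N * (1 - 2 * (u))"
    "triangle_wave (of_int N + u - e) = (-1) powi N * (1 - 2 * (u - e))"
    "triangle_wave (of_int N + u + i) = (-1) powi N * (1 - 2 * (u + i))"
    using assms triangle_wave_near_int [of "of_int N + u" N]
      triangle_wave_near_int [of "of_int N + u - e" N]
      triangle_wave_near_int [of "of_int N + u + i" N]
    by simp_all
  show ?thesis unfolding v kink_def t by (simp add: algebra_simps)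
qed

lemma kink_above:
  assumes "0 \<le> u" "u \<le> e" "0 \<le> i" "u + i \<le> 1" "e \<le> 1"
  shows "kink e i (of_int n + u) = (-1) powi n * (4 * i * (e - u))"
proof -
  have t: "triangle_wave (of_int n + u) = (-1) powi n * (1 - 2 * (u))"
    "triangle_wave (of_int n + u - e) = (-1) powi n * (1 - 2 * (e - u))"
    "triangle_wave (of_int n + u + i) = (-1) powi n * (1 - 2 * (u + i))"
    using assms triangle_wave_near_int [of "of_int n + u" n]
      triangle_wave_near_int [of "of_int n + u - e" n]
      triangle_wave_near_int [of "of_int n + u + i" n]
    by simp_all
  show ?thesis unfolding kink_def t by (simp add: algebra_simps)
qed

lemma kink_below:
  assumes "0 \<le> w" "w \<le> i" "0 \<le> e" "w + e \<le> 1" "i \<le> 1"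
  shows "kink e i (of_int n - w) = (-1) powi n * (4 * e * (i - w))"
proof -
  have t: "triangle_wave (of_int n - w) = (-1) powi n * (1 - 2 * (w))"
    "triangle_wave (of_int n - w - e) = (-1) powi n * (1 - 2 * (w + e))"
    "triangle_wave (of_int n - w + i) = (-1) powi n * (1 - 2 * (i - w))"
    using assms triangle_wave_near_int [of "of_int n - w" n]
      triangle_wave_near_int [of "of_int n - w - e" n]
      triangle_wave_near_int [of "of_int n - w + i" n]
    by simp_all
  show ?thesis unfolding kink_def t by (simp add: algebra_simps)
qed

section \<open>Extremal fractional parts of multiples\<close>

lemma eps_frac: "eps \<theta> j = frac (real (xi \<theta> j) * (\<theta> / (2 * pi)))"
  by (simp add: eps_def frac_def)

lemma iota_frac: "iota \<theta> j = 1 - frac (real (eta \<theta> j) * (\<theta> / (2 * pi)))"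
  by (simp add: iota_def frac_def)

lemma xi_range: "j \<ge> 1 \<Longrightarrow> xi \<theta> j \<in> {1..j}"
  and eta_range: "j \<ge> 1 \<Longrightarrow> eta \<theta> j \<in> {1..j}"
  unfolding xi_def eta_def by (rule arg_min_if_finite(1); simp)+

text \<open>This keeps the degrees of the two correction terms in the numerator below \<open>n\<close>.\<close>

lemma gap_index_lt:
  assumes "n \<ge> 1"
  shows "\<bar>int n - int (xi \<theta> (2 * n - 1))\<bar> < int n" "\<bar>int n - int (eta \<theta> (2 * n - 1))\<bar> < int n"
proof -
  have "2 * n - 1 \<ge> 1" using assms by simp
  from xi_range [OF this, of \<theta>] eta_range [OF this, of \<theta>] assms
  show "\<bar>int n - int (xi \<theta> (2 * n - 1))\<bar> < int n" "\<bar>int n - int (eta \<theta> (2 * n - 1))\<bar> < int n"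
    unfolding atLeastAtMost_iff by linarith+
qed

lemma eps_le: "p \<in> {1..j} \<Longrightarrow> eps \<theta> j \<le> frac (real p * (\<theta> / (2 * pi)))"
  unfolding eps_def xi_def frac_def times_divide_eq_right by (rule arg_min_least) auto

lemma iota_le: "p \<in> {1..j} \<Longrightarrow> iota \<theta> j \<le> 1 - frac (real p * (\<theta> / (2 * pi)))"
  using arg_min_least [of "{1..j}" p "\<lambda>p. of_int \<lfloor>real p * \<theta> / (2 * pi)\<rfloor> + 1 - real p * \<theta> / (2 * pi)"]
  unfolding iota_def eta_def frac_def times_divide_eq_right by auto

lemma eps_Suc: "j \<ge> 1 \<Longrightarrow> eps \<theta> (Suc j) = min (eps \<theta> j) (frac (real (Suc j) * (\<theta> / (2 * pi))))"
proof (rule antisym)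
  assume "j \<ge> 1"
  show "eps \<theta> (Suc j) \<le> min (eps \<theta> j) (frac (real (Suc j) * (\<theta> / (2 * pi))))"
    using eps_le [of "Suc j" "Suc j"] eps_le [of "xi \<theta> j" "Suc j"] xi_range [OF \<open>j \<ge> 1\<close>, of \<theta>]
    by (auto simp: eps_frac [of _ j])
  show "min (eps \<theta> j) (frac (real (Suc j) * (\<theta> / (2 * pi)))) \<le> eps \<theta> (Suc j)"
    using eps_le [of "xi \<theta> (Suc j)" j \<theta>] xi_range [of "Suc j" \<theta>]
    by (cases "xi \<theta> (Suc j) = Suc j") (auto simp: eps_frac [of _ "Suc j"])
qed

lemma iota_Suc: "j \<ge> 1 \<Longrightarrow> iota \<theta> (Suc j) = min (iota \<theta> j) (1 - frac (real (Suc j) * (\<theta> / (2 * pi))))"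
proof (rule antisym)
  assume "j \<ge> 1"
  show "iota \<theta> (Suc j) \<le> min (iota \<theta> j) (1 - frac (real (Suc j) * (\<theta> / (2 * pi))))"
    using iota_le [of "Suc j" "Suc j"] iota_le [of "eta \<theta> j" "Suc j"] eta_range [OF \<open>j \<ge> 1\<close>, of \<theta>]
    by (auto simp: iota_frac [of _ j])
  show "min (iota \<theta> j) (1 - frac (real (Suc j) * (\<theta> / (2 * pi)))) \<le> iota \<theta> (Suc j)"
    using iota_le [of "eta \<theta> (Suc j)" j \<theta>] eta_range [of "Suc j" \<theta>]
    by (cases "eta \<theta> (Suc j) = Suc j") (auto simp: iota_frac [of _ "Suc j"])
qed

lemma iota_pos: "iota \<theta> j > 0"
  using frac_lt_1 by (simp add: iota_frac)

lemma eps_nonneg: "eps \<theta> j \<ge> 0"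
  by (simp add: eps_frac)

text \<open>Without irrationality the minimum could be \<open>0\<close>, and the normalising square root would vanish.\<close>

lemma eps_pos:
  assumes "\<theta> / pi \<notin> \<rat>" "j \<ge> 1"
  shows "eps \<theta> j > 0"
proof -
  define p where "p = xi \<theta> j"
  have p: "p \<ge> 1" using xi_range [OF assms(2)] by (simp add: p_def)
  have "real p * (\<theta> / (2 * pi)) \<notin> \<int>"
  proof
    assume "real p * (\<theta> / (2 * pi)) \<in> \<int>"
    then obtain k where "real p * (\<theta> / (2 * pi)) = of_int k" by (auto elim: Ints_cases)
    then have "\<theta> / pi = of_int (2 * k) / of_int (int p)" using p by (simp add: field_simps)
    then show False using assms(1) by (metis Rats_divide Rats_of_int)
  qed
  then show ?thesis by (simp add: eps_frac p_def)
qed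

text \<open>Comparing both minima with the index \<open>1\<close>, where the two distances to the neighbouring integers
  add up to \<open>1\<close>. In particular no index can improve both records at once.\<close>

lemma eps_iota_le_1: "j \<ge> 1 \<Longrightarrow> eps \<theta> j + iota \<theta> j \<le> 1"
  using eps_le [of 1 j \<theta>] iota_le [of 1 j \<theta>] by auto

text \<open>If \<open>2 * n\<close> sets no record, both sides are \<open>0\<close>. If it sets one, at distance \<open>u\<close> from an
  integer \<open>N\<close>, then \<open>N\<close> is odd: for even \<open>N\<close> the index \<open>n\<close> would have distance \<open>u / 2\<close>
  on the same side, beating the record over \<open>{1..2 * n - 1}\<close>. So the kink at \<open>N\<close> points downwards,
  and its contribution replaces one factor of \<open>eps * iota\<close> by the new record.\<close>

lemma kink_doubled:
  assumes "n \<ge> 1"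
  shows "kink (eps \<theta> (2 * n - 1)) (iota \<theta> (2 * n - 1)) (real (2 * n) * (\<theta> / (2 * pi)))
    = 4 * (eps \<theta> (2 * n) * iota \<theta> (2 * n) - eps \<theta> (2 * n - 1) * iota \<theta> (2 * n - 1))"
proof -
  define x where "x = real n * (\<theta> / (2 * pi))"
  define e where "e = eps \<theta> (2 * n - 1)"
  define i where "i = iota \<theta> (2 * n - 1)"
  have x2: "real (2 * n) * (\<theta> / (2 * pi)) = 2 * x" by (simp add: x_def)
  have Suc: "Suc (2 * n - 1) = 2 * n" using assms by simp
  have e': "eps \<theta> (2 * n) = min e (frac (2 * x))"
    and i': "iota \<theta> (2 * n) = min i (1 - frac (2 * x))"
    using eps_Suc [of "2 * n - 1" \<theta>] iota_Suc [of "2 * n - 1" \<theta>] assms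
    unfolding Suc x2 e_def i_def by auto
  have ex: "e \<le> frac x" and ix: "i \<le> 1 - frac x"
    using assms eps_le [of n "2 * n - 1" \<theta>] iota_le [of n "2 * n - 1" \<theta>]
    unfolding e_def i_def x_def by simp_all
  have e0: "0 \<le> e" and i0: "0 < i" and ei: "e + i \<le> 1"
    using assms by (auto simp: e_def i_def eps_nonneg iota_pos eps_iota_le_1)
  \<comment> \<open>Both records cannot be broken together because \<open>e + i \<le> 1\<close>, so each case changes at most one.\<close>
  consider "e \<le> frac (2 * x)" "i \<le> 1 - frac (2 * x)" | "frac (2 * x) < e" | "1 - frac (2 * x) < i"
    by linarith
  then have "kink e i (2 * x) = 4 * (eps \<theta> (2 * n) * iota \<theta> (2 * n) - e * i)"
  proof cases
    case 1
    then show ?thesis using kink_linear e0 i0 by (simp add: e' i')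
  next
    case 2
    define u where "u = frac (2 * x)"
    define N where "N = \<lfloor>2 * x\<rfloor>"
    have u: "2 * x = of_int N + u" "0 \<le> u" "u < e" "u < 1"
      using 2 frac_lt_1 [of "2 * x"] by (simp_all add: u_def N_def frac_def)
    have "odd N"
    proof
      assume "even N"
      then obtain k where "N = 2 * k" by (auto elim: evenE)
      then have "x = of_int k + u / 2" using u by simp
      then have "frac x = u / 2" using u by (simp add: frac_eq)
      then show False using ex u by linarith
    qed
    moreover have "kink e i (of_int N + u) = (-1) powi N * (4 * i * (e - u))"
      using u e0 i0 ei by (intro kink_above) auto
    moreover have "eps \<theta> (2 * n) = u" "iota \<theta> (2 * n) = i"
      using u ei by (auto simp: e' i' simp flip: u_def)
    ultimately show ?thesis unfolding u(1) by (simp add: power_int_minus_left algebra_simps)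
  next
    case 3
    define w where "w = 1 - frac (2 * x)"
    define N where "N = \<lfloor>2 * x\<rfloor> + 1"
    have w: "2 * x = of_int N - w" "0 < w" "w < i" "w \<le> 1"
      using 3 frac_lt_1 [of "2 * x"] frac_ge_0 [of "2 * x"] by (simp_all add: w_def N_def frac_def)
    have "odd N"
    proof
      assume "even N"
      then obtain k where "N = 2 * k" by (auto elim: evenE)
      then have "x = of_int (k - 1) + (1 - w / 2)" using w by simp
      then have "frac x = 1 - w / 2" using w by (simp only: frac_add_of_int_left) (simp add: frac_eq)
      then show False using ix w by linarith
    qed
    moreover have "kink e i (of_int N - w) = (-1) powi N * (4 * e * (i - w))"
      using w e0 i0 ei by (intro kink_below) auto
    moreover have "iota \<theta> (2 * n) = w" "eps \<theta> (2 * n) = e"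
      using w ei by (auto simp: e' i' w_def)
    ultimately show ?thesis unfolding w(1) by (simp add: power_int_minus_left algebra_simps)
  qed
  then show ?thesis by (simp only: x2 e_def i_def)
qed

section \<open>The orthogonal polynomials\<close>

definition gap_poly :: "real \<Rightarrow> nat \<Rightarrow> real poly" where
  "gap_poly \<theta> n =
     smult (eps \<theta> (2 * n - 1) + iota \<theta> (2 * n - 1)) (cheb_int (int n))
     - smult ((-1) powi \<lfloor>real (xi \<theta> (2 * n - 1)) * \<theta> / (2 * pi)\<rfloor> * iota \<theta> (2 * n - 1))
         (cheb_int (int n - int (xi \<theta> (2 * n - 1))))
     + smult ((-1) powi \<lfloor>real (eta \<theta> (2 * n - 1)) * \<theta> / (2 * pi)\<rfloor> * eps \<theta> (2 * n - 1))
         (cheb_int (int n - int (eta \<theta> (2 * n - 1))))"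

text \<open>A shift of the argument by \<open>\<xi> * \<alpha>\<close> is a shift by \<open>eps\<close> followed by an integer shift, which
  multiplies the wave by the sign occurring in \<open>gap_poly\<close>. A shift by \<open>\<eta> * \<alpha>\<close> is a shift by
  \<open>- iota\<close> followed by a shift by the floor plus \<open>1\<close>; this extra unit accounts for the opposite
  signs of the two correction terms.\<close>

lemma poly_inner_gap_poly_cheb_int:
  "poly_inner (disc_measure \<theta>) (gap_poly \<theta> n) (cheb_int m)
   = pi\<^sup>2 / 2 * (kink (eps \<theta> (2 * n - 1)) (iota \<theta> (2 * n - 1)) (of_int (int n + m) * (\<theta> / (2 * pi)))
               + kink (eps \<theta> (2 * n - 1)) (iota \<theta> (2 * n - 1)) (of_int (int n - m) * (\<theta> / (2 * pi))))"
proof -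
  define \<alpha> where "\<alpha> = \<theta> / (2 * pi)"
  define e where "e = eps \<theta> (2 * n - 1)"
  define i where "i = iota \<theta> (2 * n - 1)"
  define X where "X = xi \<theta> (2 * n - 1)"
  define Y where "Y = eta \<theta> (2 * n - 1)"
  define s where "s = \<lfloor>real X * \<theta> / (2 * pi)\<rfloor>"
  define t where "t = \<lfloor>real Y * \<theta> / (2 * pi)\<rfloor>"
  have X: "real X * \<alpha> = of_int s + e" by (simp add: e_def eps_def X_def s_def \<alpha>_def)
  have Y: "real Y * \<alpha> = of_int t + 1 - i" by (simp add: i_def iota_def Y_def t_def \<alpha>_def)
  have a: "triangle_wave (of_int (int n - int X + k) * \<alpha>) = (-1) powi s * triangle_wave (of_int (int n + k) * \<alpha> - e)" for k
  proof -
    have "of_int (int n - int X + k) * \<alpha> = (of_int (int n + k) * \<alpha> - e) + of_int (- s)"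
      using X by (simp add: algebra_simps)
    then show ?thesis by (simp only: triangle_wave_add_int power_int_minus_one_minus)
  qed
  have b: "triangle_wave (of_int (int n - int Y + k) * \<alpha>) = (-1) powi t * - triangle_wave (of_int (int n + k) * \<alpha> + i)" for k
  proof -
    have "of_int (int n - int Y + k) * \<alpha> = (of_int (int n + k) * \<alpha> + i) + of_int (- (t + 1))"
      using Y by (simp add: algebra_simps)
    then show ?thesis by (simp only: triangle_wave_add_int power_int_minus_one_minus) (simp add: power_int_add)
  qed
  have unsign: "(-1) powi k * z * (c * ((-1) powi k * x + (-1) powi k * y)) = z * (c * (x + y))"
    for k :: int and z c x y :: real
  proof -
    have "(-1) powi k * z * (c * ((-1) powi k * x + (-1) powi k * y))
        = ((-1) powi k * (-1) powi k) * (z * (c * (x + y)))"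
      by (simp only: distrib_left mult_ac)
    then show ?thesis by simp
  qed
  have A: "(-1) powi s * i * (pi\<^sup>2 / 2 * (triangle_wave (of_int (int n - int X + m) * \<alpha>) + triangle_wave (of_int (int n - int X - m) * \<alpha>)))
      = i * (pi\<^sup>2 / 2 * (triangle_wave (of_int (int n + m) * \<alpha> - e) + triangle_wave (of_int (int n - m) * \<alpha> - e)))"
    using a [of m] a [of "- m", unfolded add_uminus_conv_diff] by (simp only: unsign)
  have B: "(-1) powi t * e * (pi\<^sup>2 / 2 * (triangle_wave (of_int (int n - int Y + m) * \<alpha>) + triangle_wave (of_int (int n - int Y - m) * \<alpha>)))
      = e * (pi\<^sup>2 / 2 * (- triangle_wave (of_int (int n + m) * \<alpha> + i) + - triangle_wave (of_int (int n - m) * \<alpha> + i)))"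
    using b [of m] b [of "- m", unfolded add_uminus_conv_diff] by (simp only: unsign)
  have "poly_inner (disc_measure \<theta>) (gap_poly \<theta> n) (cheb_int m)
    = (e + i) * (pi\<^sup>2 / 2 * (triangle_wave (of_int (int n + m) * \<alpha>) + triangle_wave (of_int (int n - m) * \<alpha>)))
      - (-1) powi s * i * (pi\<^sup>2 / 2 * (triangle_wave (of_int (int n - int X + m) * \<alpha>) + triangle_wave (of_int (int n - int X - m) * \<alpha>)))
      + (-1) powi t * e * (pi\<^sup>2 / 2 * (triangle_wave (of_int (int n - int Y + m) * \<alpha>) + triangle_wave (of_int (int n - int Y - m) * \<alpha>)))"
    unfolding gap_poly_def poly_inner_linear [OF disc_integrable_poly] poly_inner_cheb_int
    by (simp only: e_def i_def X_def Y_def s_def t_def \<alpha>_def)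
  also have "\<dots> = pi\<^sup>2 / 2 * (kink e i (of_int (int n + m) * \<alpha>) + kink e i (of_int (int n - m) * \<alpha>))"
    unfolding A B kink_def by (simp add: algebra_simps add_divide_distrib)
  finally show ?thesis by (simp only: e_def i_def \<alpha>_def)
qed

lemma poly_inner_gap_poly_lower:
  assumes "\<bar>m\<bar> < int n"
  shows "poly_inner (disc_measure \<theta>) (gap_poly \<theta> n) (cheb_int m) = 0"
proof -
  have z: "kink (eps \<theta> (2 * n - 1)) (iota \<theta> (2 * n - 1)) (of_int k * (\<theta> / (2 * pi))) = 0"
    if "0 < k" "k < 2 * int n" for k :: int
  proof (rule kink_linear)
    have k: "nat k \<in> {1..2 * n - 1}" "of_int k = real (nat k)" using that by auto
    show "eps \<theta> (2 * n - 1) \<le> frac (of_int k * (\<theta> / (2 * pi)))"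
      unfolding k(2) using k(1) by (rule eps_le)
    show "iota \<theta> (2 * n - 1) \<le> 1 - frac (of_int k * (\<theta> / (2 * pi)))"
      unfolding k(2) using k(1) by (rule iota_le)
  qed (simp_all add: eps_nonneg iota_pos less_imp_le)
  have "0 < int n + m" "int n + m < 2 * int n" "0 < int n - m" "int n - m < 2 * int n"
    using assms by linarith+
  then show ?thesis
    unfolding poly_inner_gap_poly_cheb_int by (simp only: z) simp
qed

text \<open>By orthogonality to lower degrees only the leading term of the second factor counts.\<close>

lemma poly_inner_gap_poly_self:
  assumes "n \<ge> 1"
  shows "poly_inner (disc_measure \<theta>) (gap_poly \<theta> n) (gap_poly \<theta> n)
    = 2 * pi\<^sup>2 * eps \<theta> (2 * n) * iota \<theta> (2 * n) * (eps \<theta> (2 * n - 1) + iota \<theta> (2 * n - 1))"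
proof -
  define e where "e = eps \<theta> (2 * n - 1)"
  define i where "i = iota \<theta> (2 * n - 1)"
  let ?I = "poly_inner (disc_measure \<theta>)"
  have "0 \<le> e" "0 < i" "e + i \<le> 1"
    using assms by (auto simp: e_def i_def eps_nonneg iota_pos eps_iota_le_1)
  then have 0: "kink e i 0 = 4 * i * e"
    using kink_above [of 0 e i 0] by simp
  have 2: "kink e i (of_int (int n + int n) * (\<theta> / (2 * pi))) = 4 * (eps \<theta> (2 * n) * iota \<theta> (2 * n) - e * i)"
    using kink_doubled [OF assms] by (simp add: e_def i_def)
  have "?I (gap_poly \<theta> n) (cheb_int (int n)) = 2 * pi\<^sup>2 * (eps \<theta> (2 * n) * iota \<theta> (2 * n))"
    unfolding poly_inner_gap_poly_cheb_int
    unfolding e_def [symmetric] i_def [symmetric] 2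
    by (simp add: 0 algebra_simps)
  moreover have "?I (gap_poly \<theta> n) (cheb_int (int n - int (xi \<theta> (2 * n - 1)))) = 0"
    "?I (gap_poly \<theta> n) (cheb_int (int n - int (eta \<theta> (2 * n - 1)))) = 0"
    by (rule poly_inner_gap_poly_lower, rule gap_index_lt [OF assms])+
  ultimately show ?thesis
    by (subst (2) gap_poly_def, subst poly_inner_commute)
       (simp add: poly_inner_linear [OF disc_integrable_poly] poly_inner_commute [of _ "cheb_int _"])
qed

lemma degree_cheb_int: "degree (cheb_int k) = nat \<bar>k\<bar>"
  by (simp add: cheb_int_def cheb_T_eq_cheb_rec degree_cheb_rec)

lemma coeff_cheb_rec_pos: "coeff (cheb_rec m) m > 0"
proof (induction m rule: cheb_rec.induct)
  case (3 m)
  have "coeff (cheb_rec m) (Suc (Suc m)) = 0"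
    by (rule coeff_eq_0) (simp add: degree_cheb_rec)
  then show ?case using 3 by simp
qed auto

lemma degree_gap_poly:
  assumes "n \<ge> 1"
  shows "degree (gap_poly \<theta> n) = n" "lead_coeff (gap_poly \<theta> n) > 0"
proof -
  have lo: "degree (cheb_int (int n - int (xi \<theta> (2 * n - 1)))) < n"
    "degree (cheb_int (int n - int (eta \<theta> (2 * n - 1)))) < n"
    using gap_index_lt [OF assms, of \<theta>] unfolding degree_cheb_int by linarith+
  have "eps \<theta> (2 * n - 1) + iota \<theta> (2 * n - 1) > 0"
    by (simp add: add_nonneg_pos eps_nonneg iota_pos)
  then have c: "coeff (gap_poly \<theta> n) n > 0"
    using coeff_cheb_rec_pos [of n]
    unfolding gap_poly_def coeff_add coeff_diff coeff_smult coeff_eq_0 [OF lo(1)] coeff_eq_0 [OF lo(2)]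
    by (simp add: cheb_int_def cheb_T_eq_cheb_rec)
  have "degree (gap_poly \<theta> n) \<le> n"
    unfolding gap_poly_def using lo
    by (intro degree_add_le degree_diff_le degree_smult_le [THEN order_trans]) (auto simp: degree_cheb_int)
  then show "degree (gap_poly \<theta> n) = n" using c by (auto intro!: antisym le_degree)
  then show "lead_coeff (gap_poly \<theta> n) > 0" using c by simp
qed

definition orthonormal_gap_poly :: "real \<Rightarrow> nat \<Rightarrow> real poly" where
  "orthonormal_gap_poly \<theta> n =
     (if n = 0 then [:inverse pi:]
      else smult (1 / sqrt (2 * pi\<^sup>2 * eps \<theta> (2 * n) * iota \<theta> (2 * n)
                        * (eps \<theta> (2 * n - 1) + iota \<theta> (2 * n - 1)))) (gap_poly \<theta> n))"

lemma orthonormal_polys_gap_poly: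
  assumes "\<theta> / pi \<notin> \<rat>"
  shows "orthonormal_polys (disc_measure \<theta>) (orthonormal_gap_poly \<theta>)"
proof -
  let ?I = "poly_inner (disc_measure \<theta>)" and ?q = "orthonormal_gap_poly \<theta>"
  note lin = poly_inner_linear [OF disc_integrable_poly]
  define A where "A n = 2 * pi\<^sup>2 * eps \<theta> (2 * n) * iota \<theta> (2 * n)
                        * (eps \<theta> (2 * n - 1) + iota \<theta> (2 * n - 1))" for n
  have A: "A n > 0" if "n \<ge> 1" for n
    using that eps_pos [OF assms, of "2 * n"]
    by (auto simp: A_def iota_pos eps_nonneg intro!: mult_pos_pos add_nonneg_pos)
  have q: "?q n = smult (1 / sqrt (A n)) (gap_poly \<theta> n)" if "n \<ge> 1" for n
    using that by (simp add: orthonormal_gap_poly_def A_def)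
  have deg: "degree (?q n) = n \<and> lead_coeff (?q n) > 0" for n
  proof (cases "n = 0")
    case False
    then show ?thesis using q [of n] A [of n] degree_gap_poly [of n \<theta>] by simp
  qed (simp add: orthonormal_gap_poly_def)
  have low: "?I (?q n) (?q m) = 0" if "m < n" for n m
  proof -
    have "?I (gap_poly \<theta> n) (?q m) = 0"
    proof (rule orthogonal_lower_degree [OF disc_integrable_poly, where b = "\<lambda>m. cheb_int (int m)" and n = n])
      show "degree (cheb_int (int m)) = m \<and> cheb_int (int m) \<noteq> 0" for m
        using coeff_cheb_rec_pos [of m] by (auto simp: degree_cheb_int) (simp add: cheb_int_def cheb_T_eq_cheb_rec)
      show "?I (gap_poly \<theta> n) (cheb_int (int m)) = 0" if "m < n" for m
        using that by (intro poly_inner_gap_poly_lower) simp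
      show "degree (?q m) < n" using deg that by simp
    qed
    then show ?thesis using q [of n] that by (simp add: lin)
  qed
  have self: "?I (?q n) (?q n) = 1" for n
  proof (cases "n = 0")
    case True
    have "?I 1 1 = pi\<^sup>2"
      using poly_inner_cheb_int [of \<theta> 0 0] triangle_wave_near_zero [of 0] by (simp add: cheb_int_def cheb_T_eq_cheb_rec)
    moreover have "?q n = smult (inverse pi) 1" using True by (simp add: orthonormal_gap_poly_def)
    ultimately show ?thesis
      by (simp only: lin poly_inner_smult_right) (simp add: power2_eq_square field_simps)
  next
    case False
    then have "?I (?q n) (?q n) = 1 / sqrt (A n) * (1 / sqrt (A n) * A n)"
      using poly_inner_gap_poly_self [of n \<theta>] q [of n]
      by (simp add: lin poly_inner_smult_right A_def)
    then show ?thesis using A [of n] False by (simp add: real_div_sqrt)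
  qed
  show ?thesis
    unfolding orthonormal_polys_iff [OF disc_integrable_poly]
  proof (intro conjI allI)
    show "?I (?q n) (?q m) = (if n = m then 1 else 0)" for n m
      using low [of m n] low [of n m] self poly_inner_commute [of _ "?q n" "?q m"]
      by (cases n m rule: linorder_cases) auto
    show "degree (?q n) = n" "lead_coeff (?q n) > 0" for n
      using deg [THEN conjunct1] deg [THEN conjunct2] by this
  qed
qed

theorem mainTheorem2:
  fixes \<theta> :: real and p :: "nat \<Rightarrow> real poly"
  assumes "\<theta> / pi \<notin> \<rat>"
  shows "orthonormal_polys (disc_measure \<theta>) p \<longleftrightarrow>
    p 0 = [:inverse pi:] \<and>
    (\<forall>n\<ge>1. p n =
      smult (1 / sqrt (2 * pi\<^sup>2 * eps \<theta> (2 * n) * iota \<theta> (2 * n)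
                        * (eps \<theta> (2 * n - 1) + iota \<theta> (2 * n - 1))))
        (smult (eps \<theta> (2 * n - 1) + iota \<theta> (2 * n - 1)) (cheb_T n)
         - smult ((-1) powi \<lfloor>real (xi \<theta> (2 * n - 1)) * \<theta> / (2 * pi)\<rfloor> * iota \<theta> (2 * n - 1))
             (cheb_T (nat \<bar>int n - int (xi \<theta> (2 * n - 1))\<bar>))
         + smult ((-1) powi \<lfloor>real (eta \<theta> (2 * n - 1)) * \<theta> / (2 * pi)\<rfloor> * eps \<theta> (2 * n - 1))
             (cheb_T (nat \<bar>int n - int (eta \<theta> (2 * n - 1))\<bar>))))"
    (is "_ \<longleftrightarrow> p 0 = _ \<and> (\<forall>n\<ge>1. p n = ?f n)")
proof -
  have f: "?f n = orthonormal_gap_poly \<theta> n" if "n \<ge> 1" for n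
    using that by (simp add: orthonormal_gap_poly_def gap_poly_def cheb_int_def)
  have "orthonormal_polys (disc_measure \<theta>) p \<longleftrightarrow> p = orthonormal_gap_poly \<theta>"
    using orthonormal_polys_unique [OF disc_integrable_poly] orthonormal_polys_gap_poly [OF assms]
    by blast
  also have "\<dots> \<longleftrightarrow> p 0 = [:inverse pi:] \<and> (\<forall>n\<ge>1. p n = ?f n)"
  proof -
    have "(\<forall>n\<ge>1. p n = ?f n) \<longleftrightarrow> (\<forall>n\<ge>1. p n = orthonormal_gap_poly \<theta> n)"
      by (simp only: f cong: imp_cong)
    moreover have "orthonormal_gap_poly \<theta> 0 = [:inverse pi:]"
      by (simp add: orthonormal_gap_poly_def)
    ultimately show ?thesis
      by (metis One_nat_def Suc_leI ext gr0I)
  qed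
  finally show ?thesis .
qed

end
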